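(* Let $P=(P_{ij})_{i,j\in\mathbb{S}}$ be an irreducible transition matrix on a finite state space $\mathbb{S}$ with unique invariant distribution $\pi$. For $N\in\mathbb{N}$ consider the stationary time-homogeneous Markov chain $(X_n)_{-N\le n\le N}$ with transition matrix $P$ and $\mathbb{P}(X_n=i)=\pi_i$ for all $n$, and let $q^{\pm,(N)}(n)$, $\mu^{AB,(N)}(n)$, $f^{AB,(N)}(n)$, $k^{A\rightarrow,(N)}(n)$, $k^{\rightarrow B,(N)}(n)$ be its committors and transition statistics on the time interval $\{-N,\dots,N\}$. Let $q^\pm,\mu^{AB},f^{AB},k^{A\rightarrow},k^{\rightarrow B}$ be the corresponding (time-independent) objects for the stationary chain $(X_n)_{n\in\mathbb{Z}}$ with transition matrix $P$. Then for all $i,j\in\mathbb{S}$ and every fixed $n\in\mathbb{Z}$ (with $N$ large enough that the quantities are defined), $$\lim_{N\to\infty}q_i^{+,(N)}(n)=q_i^+,\qquad \lim_{N\to\infty}q_i^{-,(N)}(n)=q_i^-,\qquad \lim_{N\to\infty}\mu_i^{AB,(N)}(n)=\mu_i^{AB},$$ $$\lim_{N\to\infty}f_{ij}^{AB,(N)}(n)=f_{ij}^{AB},\qquad \lim_{N\to\infty}k^{A\rightarrow,(N)}(n)=k^{A\rightarrow},\qquad \lim_{N\to\infty}k^{\rightarrow B,(N)}(n)=k^{\rightarrow B}.$$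
   Context: $A,B\subset\mathbb{S}$ are non-empty disjoint subsets of the finite state space $\mathbb{S}$ with $C:=(A\cup B)^c$ non-empty. For a Markov chain $(X_n)_{n\in\mathbb{T}}$ with time set $\mathbb{T}=\mathbb{Z}$ or $\mathbb{T}=\{-N,\dots,N\}$, $S\subset\mathbb{S}$ and $n\in\mathbb{T}$: $\tau_S^+(n):=\inf\{k\in\mathbb{T}: k\ge n, X_k\in S\}$ ($\inf\emptyset:=\infty$), $\tau_S^-(n):=\sup\{k\in\mathbb{T}: k\le n, X_k\in S\}$ ($\sup\emptyset:=-\infty$). The forward and backward committors are $q_i^+(n):=\mathbb{P}(\tau_B^+(n)<\tau_A^+(n)\mid X_n=i)$, $q_i^-(n):=\mathbb{P}(\tau_A^-(n)>\tau_B^-(n)\mid X_n=i)$. The distribution of reactive trajectories is $\mu^{AB}_i(n):=\mathbb{P}(X_n=i,\tau_A^-(n)>\tau_B^-(n),\tau_B^+(n)<\tau_A^+(n))$. The current of reactive trajectories is $f^{AB}_{ij}(n):=\mathbb{P}(X_n=i,X_{n+1}=j,\tau_A^-(n)>\tau_B^-(n),\tau_B^+(n+1)<\tau_A^+(n+1))$. The discrete rates are $k^{A\rightarrow}(n):=\mathbb{P}(X_n\in A,\tau_B^+(n+1)<\tau_A^+(n+1))$ and $k^{\rightarrow B}(n):=\mathbb{P}(X_n\in B,\tau_A^-(n-1)>\tau_B^-(n-1))$. For $\mathbb{T}=\mathbb{Z}$ and a stationary chain these do not depend on $n$, and the argument $n$ is dropped. *)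

theory Defs
  imports "HOL-Probability.Probability"
begin

definition transition_matrix :: "real^'s^'s \<Rightarrow> bool" where
  "transition_matrix P \<longleftrightarrow>
     (\<forall>i j. 0 \<le> P $ i $ j) \<and> (\<forall>i. (\<Sum>j\<in>UNIV. P $ i $ j) = 1)"

(* HOL-Analysis has no power operation for matrices; iterating multiplication by P
   on the identity gives the n-th power of P. *)
definition irreducible_matrix :: "real^'s^'s \<Rightarrow> bool" where
  "irreducible_matrix P \<longleftrightarrow>
     (\<forall>i j. \<exists>n. 0 < (((\<lambda>Q. P ** Q) ^^ n) (mat 1)) $ i $ j)"

definition invariant_distribution :: "real^'s^'s \<Rightarrow> real^'s \<Rightarrow> bool" where
  "invariant_distribution P \<pi> \<longleftrightarrow>
     (\<forall>i. 0 \<le> \<pi> $ i) \<and> (\<Sum>i\<in>UNIV. \<pi> $ i) = 1 \<and> \<pi> v* P = \<pi>"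

(* The time set T is meant to be an interval of integers. The variables X n with n outside T
   are unconstrained and never used. The Markov property is stated for every finite stretch
   m, ..., n of the past, so that it also makes sense when T has no least element. *)
definition markov_chain ::
    "'w measure \<Rightarrow> int set \<Rightarrow> (int \<Rightarrow> 'w \<Rightarrow> 's::finite) \<Rightarrow> real^'s^'s \<Rightarrow> bool" where
  "markov_chain M T X P \<longleftrightarrow>
     prob_space M \<and>
     (\<forall>n\<in>T. X n \<in> measurable M (count_space UNIV)) \<and>
     (\<forall>m\<in>T. \<forall>n\<in>T. m \<le> n \<longrightarrow> n + 1 \<in> T \<longrightarrow>
        (\<forall>x j. 0 < \<P>(\<omega> in M. \<forall>k\<in>{m..n}. X k \<omega> = x k) \<longrightarrow>
           \<P>(\<omega> in M. X (n + 1) \<omega> = j \<bar> \<forall>k\<in>{m..n}. X k \<omega> = x k) = P $ x n $ j))"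

definition stationary_markov_chain ::
    "'w measure \<Rightarrow> int set \<Rightarrow> (int \<Rightarrow> 'w \<Rightarrow> 's::finite) \<Rightarrow> real^'s^'s \<Rightarrow> real^'s \<Rightarrow> bool" where
  "stationary_markov_chain M T X P \<pi> \<longleftrightarrow>
     markov_chain M T X P \<and> (\<forall>n\<in>T. \<forall>i. \<P>(\<omega> in M. X n \<omega> = i) = \<pi> $ i)"

(* Values in ereal, where the infimum of the empty set is \<infinity> and its supremum is -\<infinity>. *)
definition tau_plus ::
    "int set \<Rightarrow> (int \<Rightarrow> 'w \<Rightarrow> 's) \<Rightarrow> 's set \<Rightarrow> int \<Rightarrow> 'w \<Rightarrow> ereal" where
  "tau_plus T X S n \<omega> = (INF k\<in>{k\<in>T. n \<le> k \<and> X k \<omega> \<in> S}. ereal (real_of_int k))"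

definition tau_minus ::
    "int set \<Rightarrow> (int \<Rightarrow> 'w \<Rightarrow> 's) \<Rightarrow> 's set \<Rightarrow> int \<Rightarrow> 'w \<Rightarrow> ereal" where
  "tau_minus T X S n \<omega> = (SUP k\<in>{k\<in>T. k \<le> n \<and> X k \<omega> \<in> S}. ereal (real_of_int k))"

definition q_plus ::
    "'w measure \<Rightarrow> int set \<Rightarrow> (int \<Rightarrow> 'w \<Rightarrow> 's) \<Rightarrow> 's set \<Rightarrow> 's set \<Rightarrow> 's \<Rightarrow> int \<Rightarrow> real" where
  "q_plus M T X A B i n =
     \<P>(\<omega> in M. tau_plus T X B n \<omega> < tau_plus T X A n \<omega> \<bar> X n \<omega> = i)"

definition q_minus ::
    "'w measure \<Rightarrow> int set \<Rightarrow> (int \<Rightarrow> 'w \<Rightarrow> 's) \<Rightarrow> 's set \<Rightarrow> 's set \<Rightarrow> 's \<Rightarrow> int \<Rightarrow> real" where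
  "q_minus M T X A B i n =
     \<P>(\<omega> in M. tau_minus T X A n \<omega> > tau_minus T X B n \<omega> \<bar> X n \<omega> = i)"

definition mu_AB ::
    "'w measure \<Rightarrow> int set \<Rightarrow> (int \<Rightarrow> 'w \<Rightarrow> 's) \<Rightarrow> 's set \<Rightarrow> 's set \<Rightarrow> 's \<Rightarrow> int \<Rightarrow> real" where
  "mu_AB M T X A B i n =
     \<P>(\<omega> in M. X n \<omega> = i \<and> tau_minus T X A n \<omega> > tau_minus T X B n \<omega>
        \<and> tau_plus T X B n \<omega> < tau_plus T X A n \<omega>)"

definition f_AB ::
    "'w measure \<Rightarrow> int set \<Rightarrow> (int \<Rightarrow> 'w \<Rightarrow> 's) \<Rightarrow> 's set \<Rightarrow> 's set \<Rightarrow> 's \<Rightarrow> 's \<Rightarrow> int \<Rightarrow> real" where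
  "f_AB M T X A B i j n =
     \<P>(\<omega> in M. X n \<omega> = i \<and> X (n + 1) \<omega> = j \<and> tau_minus T X A n \<omega> > tau_minus T X B n \<omega>
        \<and> tau_plus T X B (n + 1) \<omega> < tau_plus T X A (n + 1) \<omega>)"

definition k_from_A ::
    "'w measure \<Rightarrow> int set \<Rightarrow> (int \<Rightarrow> 'w \<Rightarrow> 's) \<Rightarrow> 's set \<Rightarrow> 's set \<Rightarrow> int \<Rightarrow> real" where
  "k_from_A M T X A B n =
     \<P>(\<omega> in M. X n \<omega> \<in> A \<and> tau_plus T X B (n + 1) \<omega> < tau_plus T X A (n + 1) \<omega>)"

definition k_to_B ::
    "'w measure \<Rightarrow> int set \<Rightarrow> (int \<Rightarrow> 'w \<Rightarrow> 's) \<Rightarrow> 's set \<Rightarrow> 's set \<Rightarrow> int \<Rightarrow> real" where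
  "k_to_B M T X A B n =
     \<P>(\<omega> in M. X n \<omega> \<in> B \<and> tau_minus T X A (n - 1) \<omega> > tau_minus T X B (n - 1) \<omega>)"

end

theory Submission
  imports Defs
begin

text \<open>
  The law of a stationary chain on a finite stretch of times is determined by \<open>P\<close> and \<open>\<pi>\<close>: a path
  \<open>x\<close> has probability \<open>\<pi>(x\<^sub>a) P(x\<^sub>a, x\<^sub>a\<^sub>+\<^sub>1) \<dots> P(x\<^sub>b\<^sub>-\<^sub>1, x\<^sub>b)\<close>, whatever the chain, its
  time set, or the position of the stretch (\<open>prob_cylinder\<close>). Hence every statistic of the chain on
  \<open>{-N..N}\<close> at time \<open>n\<close> can be computed on the probability space of the two-sided chain, as the
  probability of the same event observed through the window \<open>{-N..N}\<close> shifted by \<open>m - n\<close>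
  (\<open>prob_window_event\<close>). All the events now live on one space, and it remains to let the window grow.

  The comparison of hitting times says: the path visits the target before the forbidden set. Such
  a visit happens at a finite time, so a large enough window sees it; and a
  window that contains the starting time cannot report a visit that does not take place, because it
  sees everything in between. Therefore, along each single path, the windowed event agrees with the
  unrestricted one for all large \<open>N\<close>, and dominated convergence gives the limit of the
  probabilities (\<open>tendsto_prob_window\<close>). For the committors the conditioning event has the fixed
  probability \<open>\<pi>\<^sub>i\<close>, so only the numerator moves; if \<open>\<pi>\<^sub>i = 0\<close>, both sides are the quotient
  \<open>0 / 0 = 0\<close>.
\<close>

section \<open>Hitting times as path properties\<close>

definition visits_first ::
    "int set \<Rightarrow> int \<Rightarrow> 's set \<Rightarrow> 's set \<Rightarrow> (int \<Rightarrow> 's) \<Rightarrow> bool" where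
  "visits_first T n A B x \<longleftrightarrow>
     (\<exists>k\<in>T. n \<le> k \<and> x k \<in> B \<and> (\<forall>l\<in>T. n \<le> l \<and> l \<le> k \<longrightarrow> x l \<notin> A))"

definition visited_last ::
    "int set \<Rightarrow> int \<Rightarrow> 's set \<Rightarrow> 's set \<Rightarrow> (int \<Rightarrow> 's) \<Rightarrow> bool" where
  "visited_last T n A B x \<longleftrightarrow>
     (\<exists>k\<in>T. k \<le> n \<and> x k \<in> A \<and> (\<forall>l\<in>T. k \<le> l \<and> l \<le> n \<longrightarrow> x l \<notin> B))"

text \<open>
  An infimum of integers that are all larger than \<open>k\<close> is at least \<open>k + 1\<close>; this keeps the comparison
  strict even though the infimum is taken in the extended reals.
\<close>

lemma tau_plus_less_iff:
  "tau_plus T X B n \<omega> < tau_plus T X A n \<omega> \<longleftrightarrow> visits_first T n A B (\<lambda>k. X k \<omega>)"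
proof
  assume "tau_plus T X B n \<omega> < tau_plus T X A n \<omega>"
  then obtain k where k: "k \<in> T" "n \<le> k" "X k \<omega> \<in> B"
    and less: "ereal (real_of_int k) < tau_plus T X A n \<omega>"
    unfolding tau_plus_def[of T X B] INF_less_iff by blast
  have "X l \<omega> \<notin> A" if "l \<in> T" "n \<le> l" "l \<le> k" for l
  proof
    assume "X l \<omega> \<in> A"
    then have "tau_plus T X A n \<omega> \<le> ereal (real_of_int l)"
      unfolding tau_plus_def using that by (intro INF_lower) auto
    with less have "ereal (real_of_int k) < ereal (real_of_int l)" by (rule less_le_trans)
    with \<open>l \<le> k\<close> show False by simp
  qed
  with k show "visits_first T n A B (\<lambda>k. X k \<omega>)" unfolding visits_first_def by blast
next
  assume "visits_first T n A B (\<lambda>k. X k \<omega>)"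
  then obtain k where k: "k \<in> T" "n \<le> k" "X k \<omega> \<in> B"
    and avoid: "\<And>l. l \<in> T \<Longrightarrow> n \<le> l \<Longrightarrow> l \<le> k \<Longrightarrow> X l \<omega> \<notin> A"
    unfolding visits_first_def by blast
  have "tau_plus T X B n \<omega> \<le> ereal (real_of_int k)"
    unfolding tau_plus_def using k by (intro INF_lower) auto
  also have "\<dots> < ereal (real_of_int (k + 1))" by simp
  also have "\<dots> \<le> tau_plus T X A n \<omega>"
    unfolding tau_plus_def
  proof (rule INF_greatest)
    fix l assume "l \<in> {k \<in> T. n \<le> k \<and> X k \<omega> \<in> A}"
    with avoid[of l] have "k + 1 \<le> l" by force
    then show "ereal (real_of_int (k + 1)) \<le> ereal (real_of_int l)"
      using of_int_le_iff ereal_less_eq(3) by blast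
  qed
  finally show "tau_plus T X B n \<omega> < tau_plus T X A n \<omega>" .
qed

lemma tau_minus_less_iff:
  "tau_minus T X B n \<omega> < tau_minus T X A n \<omega> \<longleftrightarrow> visited_last T n A B (\<lambda>k. X k \<omega>)"
proof
  assume "tau_minus T X B n \<omega> < tau_minus T X A n \<omega>"
  then obtain k where k: "k \<in> T" "k \<le> n" "X k \<omega> \<in> A"
    and less: "tau_minus T X B n \<omega> < ereal (real_of_int k)"
    unfolding tau_minus_def[of T X A] less_SUP_iff by blast
  have "X l \<omega> \<notin> B" if "l \<in> T" "k \<le> l" "l \<le> n" for l
  proof
    assume "X l \<omega> \<in> B"
    then have "ereal (real_of_int l) \<le> tau_minus T X B n \<omega>"
      unfolding tau_minus_def using that by (intro SUP_upper) auto
    from this less have "ereal (real_of_int l) < ereal (real_of_int k)" by (rule le_less_trans)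
    with \<open>k \<le> l\<close> show False by simp
  qed
  with k show "visited_last T n A B (\<lambda>k. X k \<omega>)" unfolding visited_last_def by blast
next
  assume "visited_last T n A B (\<lambda>k. X k \<omega>)"
  then obtain k where k: "k \<in> T" "k \<le> n" "X k \<omega> \<in> A"
    and avoid: "\<And>l. l \<in> T \<Longrightarrow> k \<le> l \<Longrightarrow> l \<le> n \<Longrightarrow> X l \<omega> \<notin> B"
    unfolding visited_last_def by blast
  have "tau_minus T X B n \<omega> \<le> ereal (real_of_int (k - 1))"
    unfolding tau_minus_def
  proof (rule SUP_least)
    fix l assume "l \<in> {k \<in> T. k \<le> n \<and> X k \<omega> \<in> B}"
    with avoid[of l] have "l \<le> k - 1" by force
    then show "ereal (real_of_int l) \<le> ereal (real_of_int (k - 1))"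
      using of_int_le_iff ereal_less_eq(3) by blast
  qed
  also have "\<dots> < ereal (real_of_int k)" by simp
  also have "\<dots> \<le> tau_minus T X A n \<omega>"
    unfolding tau_minus_def using k by (intro SUP_upper) auto
  finally show "tau_minus T X B n \<omega> < tau_minus T X A n \<omega>" .
qed

lemma visits_first_shift:
  "visits_first UNIV n A B (\<lambda>k. x (k + d)) \<longleftrightarrow> visits_first UNIV (n + d) A B x"
proof
  assume "visits_first UNIV n A B (\<lambda>k. x (k + d))"
  then obtain k where k: "n \<le> k" "x (k + d) \<in> B"
    and avoid: "\<And>l. n \<le> l \<Longrightarrow> l \<le> k \<Longrightarrow> x (l + d) \<notin> A"
    unfolding visits_first_def by blast
  have "x l \<notin> A" if "n + d \<le> l" "l \<le> k + d" for l
    using avoid[of "l - d"] that by simp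
  with k show "visits_first UNIV (n + d) A B x"
    unfolding visits_first_def by (intro bexI[of _ "k + d"]) auto
next
  assume "visits_first UNIV (n + d) A B x"
  then obtain k where k: "n + d \<le> k" "x k \<in> B"
    and avoid: "\<And>l. n + d \<le> l \<Longrightarrow> l \<le> k \<Longrightarrow> x l \<notin> A"
    unfolding visits_first_def by blast
  have "x (l + d) \<notin> A" if "n \<le> l" "l \<le> k - d" for l
    using avoid[of "l + d"] that by simp
  with k show "visits_first UNIV n A B (\<lambda>k. x (k + d))"
    unfolding visits_first_def by (intro bexI[of _ "k - d"]) auto
qed

lemma visited_last_shift:
  "visited_last UNIV n A B (\<lambda>k. x (k + d)) \<longleftrightarrow> visited_last UNIV (n + d) A B x"
proof
  assume "visited_last UNIV n A B (\<lambda>k. x (k + d))"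
  then obtain k where k: "k \<le> n" "x (k + d) \<in> A"
    and avoid: "\<And>l. k \<le> l \<Longrightarrow> l \<le> n \<Longrightarrow> x (l + d) \<notin> B"
    unfolding visited_last_def by blast
  have "x l \<notin> B" if "k + d \<le> l" "l \<le> n + d" for l
    using avoid[of "l - d"] that by simp
  with k show "visited_last UNIV (n + d) A B x"
    unfolding visited_last_def by (intro bexI[of _ "k + d"]) auto
next
  assume "visited_last UNIV (n + d) A B x"
  then obtain k where k: "k \<le> n + d" "x k \<in> A"
    and avoid: "\<And>l. k \<le> l \<Longrightarrow> l \<le> n + d \<Longrightarrow> x l \<notin> B"
    unfolding visited_last_def by blast
  have "x (l + d) \<notin> B" if "k - d \<le> l" "l \<le> n" for l
    using avoid[of "l + d"] that by simp
  with k show "visited_last UNIV n A B (\<lambda>k. x (k + d))"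
    unfolding visited_last_def by (intro bexI[of _ "k - d"]) auto
qed

section \<open>Observing a path through growing windows\<close>

text \<open>
  The locality clause asks for large \<open>N\<close> only, since a window has to contain the reference time
  \<open>n\<close> before an event such as \<open>x n = i\<close> can be read off from it. The index \<open>N\<close> in the second clause
  may depend on the path, which is all that dominated convergence needs.
\<close>

definition window_approximates ::
    "(nat \<Rightarrow> (int \<Rightarrow> 's) \<Rightarrow> bool) \<Rightarrow> ((int \<Rightarrow> 's) \<Rightarrow> bool) \<Rightarrow> bool" where
  "window_approximates \<Phi> \<Psi> \<longleftrightarrow>
     (\<forall>\<^sub>F N in sequentially. \<forall>x y. (\<forall>k\<in>{- int N..int N}. x k = y k) \<longrightarrow> \<Phi> N x = \<Phi> N y) \<and>
     (\<forall>x. \<forall>\<^sub>F N in sequentially. \<Phi> N x = \<Psi> x)"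

lemma eventually_in_window:
  "\<forall>\<^sub>F N in sequentially. n \<in> {- int N..int N}"
  unfolding eventually_sequentially by (intro exI[of _ "nat \<bar>n\<bar>"]) auto

lemma window_approximates_conj:
  assumes "window_approximates \<Phi>\<^sub>1 \<Psi>\<^sub>1" "window_approximates \<Phi>\<^sub>2 \<Psi>\<^sub>2"
  shows "window_approximates (\<lambda>N x. \<Phi>\<^sub>1 N x \<and> \<Phi>\<^sub>2 N x) (\<lambda>x. \<Psi>\<^sub>1 x \<and> \<Psi>\<^sub>2 x)"
  unfolding window_approximates_def
proof (intro conjI allI)
  show "\<forall>\<^sub>F N in sequentially. \<forall>x y. (\<forall>k\<in>{- int N..int N}. x k = y k) \<longrightarrow>
      (\<Phi>\<^sub>1 N x \<and> \<Phi>\<^sub>2 N x) = (\<Phi>\<^sub>1 N y \<and> \<Phi>\<^sub>2 N y)"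
    using assms[unfolded window_approximates_def, THEN conjunct1]
    by (rule eventually_elim2) blast
  show "\<forall>\<^sub>F N in sequentially. (\<Phi>\<^sub>1 N x \<and> \<Phi>\<^sub>2 N x) = (\<Psi>\<^sub>1 x \<and> \<Psi>\<^sub>2 x)" for x
    using assms[unfolded window_approximates_def, THEN conjunct2, THEN spec[of _ x]]
    by (rule eventually_elim2) blast
qed

lemma window_approximates_state:
  "window_approximates (\<lambda>N x. x n \<in> S) (\<lambda>x. x n \<in> S)"
  unfolding window_approximates_def
proof (intro conjI allI)
  show "\<forall>\<^sub>F N in sequentially. \<forall>x y. (\<forall>k\<in>{- int N..int N}. x k = y k) \<longrightarrow> (x n \<in> S) = (y n \<in> S)"
    using eventually_in_window[of n] by eventually_elim auto
qed simp

text \<open>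
  A window that contains \<open>n\<close> never reports a spurious first visit, since it contains every time
  between \<open>n\<close> and the reported visit; a true first visit is reported as soon as
  the window reaches it.
\<close>

lemma window_approximates_visits_first:
  "window_approximates (\<lambda>N. visits_first {- int N..int N} n A B) (visits_first UNIV n A B)"
  unfolding window_approximates_def
proof (intro conjI allI)
  show "\<forall>\<^sub>F N in sequentially. \<forall>x y. (\<forall>k\<in>{- int N..int N}. x k = y k) \<longrightarrow>
      visits_first {- int N..int N} n A B x = visits_first {- int N..int N} n A B y"
    unfolding visits_first_def by (intro always_eventually) auto
next
  fix x :: "int \<Rightarrow> 'a"
  have sound: "visits_first UNIV n A B x"
    if n: "n \<in> {- int N..int N}" and seen: "visits_first {- int N..int N} n A B x" for N
  proof -
    obtain k where k: "k \<in> {- int N..int N}" "n \<le> k" "x k \<in> B"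
      and avoid: "\<And>l. l \<in> {- int N..int N} \<Longrightarrow> n \<le> l \<Longrightarrow> l \<le> k \<Longrightarrow> x l \<notin> A"
      using seen unfolding visits_first_def by blast
    have "x l \<notin> A" if "n \<le> l" "l \<le> k" for l
      using avoid[of l] that k(1) n by simp
    with k show ?thesis unfolding visits_first_def by blast
  qed
  show "\<forall>\<^sub>F N in sequentially. visits_first {- int N..int N} n A B x = visits_first UNIV n A B x"
  proof (cases "visits_first UNIV n A B x")
    case True
    then obtain k where k: "n \<le> k" "x k \<in> B" "\<And>l. n \<le> l \<Longrightarrow> l \<le> k \<Longrightarrow> x l \<notin> A"
      unfolding visits_first_def by blast
    show ?thesis
      using eventually_in_window[of k]
    proof eventually_elim
      case (elim N)
      then have "visits_first {- int N..int N} n A B x"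
        unfolding visits_first_def using k by blast
      with True show ?case by simp
    qed
  next
    case False
    show ?thesis
      using eventually_in_window[of n] by eventually_elim (use False sound in blast)
  qed
qed

lemma window_approximates_visited_last:
  "window_approximates (\<lambda>N. visited_last {- int N..int N} n A B) (visited_last UNIV n A B)"
  unfolding window_approximates_def
proof (intro conjI allI)
  show "\<forall>\<^sub>F N in sequentially. \<forall>x y. (\<forall>k\<in>{- int N..int N}. x k = y k) \<longrightarrow>
      visited_last {- int N..int N} n A B x = visited_last {- int N..int N} n A B y"
    unfolding visited_last_def by (intro always_eventually) auto
next
  fix x :: "int \<Rightarrow> 'a"
  have sound: "visited_last UNIV n A B x"
    if n: "n \<in> {- int N..int N}" and seen: "visited_last {- int N..int N} n A B x" for N
  proof -
    obtain k where k: "k \<in> {- int N..int N}" "k \<le> n" "x k \<in> A"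
      and avoid: "\<And>l. l \<in> {- int N..int N} \<Longrightarrow> k \<le> l \<Longrightarrow> l \<le> n \<Longrightarrow> x l \<notin> B"
      using seen unfolding visited_last_def by blast
    have "x l \<notin> B" if "k \<le> l" "l \<le> n" for l
      using avoid[of l] that k(1) n by simp
    with k show ?thesis unfolding visited_last_def by blast
  qed
  show "\<forall>\<^sub>F N in sequentially. visited_last {- int N..int N} n A B x = visited_last UNIV n A B x"
  proof (cases "visited_last UNIV n A B x")
    case True
    then obtain k where k: "k \<le> n" "x k \<in> A" "\<And>l. k \<le> l \<Longrightarrow> l \<le> n \<Longrightarrow> x l \<notin> B"
      unfolding visited_last_def by blast
    show ?thesis
      using eventually_in_window[of k]
    proof eventually_elim
      case (elim N)
      then have "visited_last {- int N..int N} n A B x"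
        unfolding visited_last_def using k by blast
      with True show ?case by simp
    qed
  next
    case False
    show ?thesis
      using eventually_in_window[of n] by eventually_elim (use False sound in blast)
  qed
qed

section \<open>Finite windows of a stationary chain\<close>

definition path_weight ::
    "real^'s^'s \<Rightarrow> real^'s \<Rightarrow> int \<Rightarrow> nat \<Rightarrow> (int \<Rightarrow> 's::finite) \<Rightarrow> real" where
  "path_weight P \<pi> a r x = \<pi> $ x a * (\<Prod>k<r. P $ x (a + int k) $ x (a + int k + 1))"

lemma cylinder_measurable:
  fixes X :: "int \<Rightarrow> 'w \<Rightarrow> 's::finite"
  assumes "\<And>k. k \<in> {a..b} \<Longrightarrow> X k \<in> measurable M (count_space UNIV)"
  shows "{\<omega> \<in> space M. \<forall>k\<in>{a..b}. X k \<omega> = x k} \<in> sets M"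
proof (rule sets.sets_Collect_finite_All)
  fix k assume "k \<in> {a..b}"
  have "X k -` {x k} \<inter> space M \<in> sets M"
    by (rule measurable_sets[OF assms[OF \<open>k \<in> {a..b}\<close>]]) simp
  also have "X k -` {x k} \<inter> space M = {\<omega> \<in> space M. X k \<omega> = x k}" by auto
  finally show "{\<omega> \<in> space M. X k \<omega> = x k} \<in> sets M" .
qed simp

lemma prob_cylinder:
  fixes X :: "int \<Rightarrow> 'w \<Rightarrow> 's::finite"
  assumes chain: "stationary_markov_chain M T X P \<pi>"
    and "{a..a + int r} \<subseteq> T"
  shows "\<P>(\<omega> in M. \<forall>k\<in>{a..a + int r}. X k \<omega> = x k) = path_weight P \<pi> a r x"
  using assms(2)
proof (induction r)
  case 0
  then have "\<P>(\<omega> in M. X a \<omega> = x a) = \<pi> $ x a"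
    using chain unfolding stationary_markov_chain_def by simp
  then show ?case by (simp add: path_weight_def)
next
  case (Suc r)
  interpret prob_space M
    using chain unfolding stationary_markov_chain_def markov_chain_def by blast
  have meas: "X k \<in> measurable M (count_space UNIV)" if "k \<in> T" for k
    using chain that unfolding stationary_markov_chain_def markov_chain_def by blast
  let ?b = "a + int r"
  let ?C = "\<lambda>\<omega>. \<forall>k\<in>{a..?b}. X k \<omega> = x k"
  let ?D = "\<lambda>\<omega>. \<forall>k\<in>{a..a + int (Suc r)}. X k \<omega> = x k"
  have sub: "{a..?b} \<subseteq> T" and ends: "a \<in> T" "?b \<in> T" "?b + 1 \<in> T"
    using Suc.prems by auto
  have IH: "\<P>(\<omega> in M. ?C \<omega>) = path_weight P \<pi> a r x"
    using Suc.IH[OF sub] .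
  have last: "{a..a + int (Suc r)} = insert (?b + 1) {a..?b}" by auto
  have D: "?D \<omega> \<longleftrightarrow> X (?b + 1) \<omega> = x (?b + 1) \<and> ?C \<omega>" for \<omega>
    unfolding last by simp
  have "\<P>(\<omega> in M. ?D \<omega>) = \<P>(\<omega> in M. ?C \<omega>) * P $ x ?b $ x (?b + 1)"
  proof (cases "0 < \<P>(\<omega> in M. ?C \<omega>)")
    case True
    have "\<P>(\<omega> in M. X (?b + 1) \<omega> = x (?b + 1) \<bar> ?C \<omega>) = P $ x ?b $ x (?b + 1)"
      using chain ends True unfolding stationary_markov_chain_def markov_chain_def by auto
    then show ?thesis
      using True unfolding cond_prob_def D by (simp add: field_simps)
  next
    case False
    then have zero: "\<P>(\<omega> in M. ?C \<omega>) = 0"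
      using measure_nonneg[of M "{\<omega> \<in> space M. ?C \<omega>}"] by linarith
    have "\<P>(\<omega> in M. ?D \<omega>) \<le> \<P>(\<omega> in M. ?C \<omega>)"
    proof (rule finite_measure_mono)
      show "{\<omega> \<in> space M. ?D \<omega>} \<subseteq> {\<omega> \<in> space M. ?C \<omega>}"
        unfolding D by blast
      show "{\<omega> \<in> space M. ?C \<omega>} \<in> events"
        by (intro cylinder_measurable meas) (use sub in blast)
    qed
    then show ?thesis
      unfolding zero mult_zero_left using measure_nonneg by (rule antisym)
  qed
  then show ?case
    unfolding IH by (simp add: path_weight_def algebra_simps)
qed

text \<open>
  The right-hand side of the second claim mentions neither the probability space nor the time set
  nor the shift \<open>d\<close>. Restricted to \<open>{a..a + r}\<close> there are only finitely many paths, so the event is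
  a finite disjoint union of cylinders.
\<close>

lemma
  fixes X :: "int \<Rightarrow> 'w \<Rightarrow> 's::finite" and \<Phi> :: "(int \<Rightarrow> 's) \<Rightarrow> bool"
  assumes chain: "stationary_markov_chain M T X P \<pi>"
    and sub: "{a + d..a + d + int r} \<subseteq> T"
    and local: "\<And>x y. (\<forall>k\<in>{a..a + int r}. x k = y k) \<Longrightarrow> \<Phi> x = \<Phi> y"
  shows window_event_measurable: "{\<omega> \<in> space M. \<Phi> (\<lambda>k. X (k + d) \<omega>)} \<in> sets M"
    and prob_window_event: "\<P>(\<omega> in M. \<Phi> (\<lambda>k. X (k + d) \<omega>)) =
      (\<Sum>x | x \<in> {a..a + int r} \<rightarrow>\<^sub>E UNIV \<and> \<Phi> x. path_weight P \<pi> a r x)"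
proof -
  interpret prob_space M
    using chain unfolding stationary_markov_chain_def markov_chain_def by blast
  have meas: "X k \<in> measurable M (count_space UNIV)" if "k \<in> T" for k
    using chain that unfolding stationary_markov_chain_def markov_chain_def by blast
  let ?I = "{a..a + int r}" and ?J = "{a + d..a + d + int r}"
  define F where "F = {x \<in> ?I \<rightarrow>\<^sub>E (UNIV :: 's set). \<Phi> x}"
  define cyl where "cyl x = {\<omega> \<in> space M. \<forall>k\<in>?J. X k \<omega> = x (k - d)}" for x
  have "finite F" unfolding F_def by (intro finite_Collect_conjI disjI1) (auto intro!: finite_PiE)
  have cyl_sets: "cyl x \<in> sets M" for x
    unfolding cyl_def by (intro cylinder_measurable meas) (use sub in blast)
  have cyl_iff: "\<omega> \<in> cyl x \<longleftrightarrow> \<omega> \<in> space M \<and> (\<forall>k\<in>?I. X (k + d) \<omega> = x k)" for x \<omega>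
  proof -
    have "(\<forall>k\<in>?J. X k \<omega> = x (k - d)) \<longleftrightarrow> (\<forall>k\<in>?I. X (k + d) \<omega> = x k)"
    proof (intro iffI ballI)
      fix k assume "\<forall>k\<in>?J. X k \<omega> = x (k - d)" "k \<in> ?I"
      then show "X (k + d) \<omega> = x k" by (elim ballE[of _ _ "k + d"]) auto
    next
      fix k assume "\<forall>k\<in>?I. X (k + d) \<omega> = x k" "k \<in> ?J"
      then show "X k \<omega> = x (k - d)" by (elim ballE[of _ _ "k - d"]) auto
    qed
    then show ?thesis unfolding cyl_def by simp
  qed
  have event: "{\<omega> \<in> space M. \<Phi> (\<lambda>k. X (k + d) \<omega>)} = (\<Union>x\<in>F. cyl x)"
  proof (intro set_eqI iffI)
    fix \<omega> assume \<omega>: "\<omega> \<in> {\<omega> \<in> space M. \<Phi> (\<lambda>k. X (k + d) \<omega>)}"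
    let ?x = "restrict (\<lambda>k. X (k + d) \<omega>) ?I"
    have "\<Phi> ?x = \<Phi> (\<lambda>k. X (k + d) \<omega>)" by (rule local) simp
    with \<omega> have "?x \<in> F" unfolding F_def by simp
    moreover have "\<omega> \<in> cyl ?x" using \<omega> unfolding cyl_iff by simp
    ultimately show "\<omega> \<in> (\<Union>x\<in>F. cyl x)" by blast
  next
    fix \<omega> assume "\<omega> \<in> (\<Union>x\<in>F. cyl x)"
    then obtain x where "x \<in> F" "\<omega> \<in> space M" "\<forall>k\<in>?I. X (k + d) \<omega> = x k"
      using cyl_iff by blast
    then show "\<omega> \<in> {\<omega> \<in> space M. \<Phi> (\<lambda>k. X (k + d) \<omega>)}"
      using local[of "\<lambda>k. X (k + d) \<omega>" x] unfolding F_def by simp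
  qed
  then show "{\<omega> \<in> space M. \<Phi> (\<lambda>k. X (k + d) \<omega>)} \<in> sets M"
    using \<open>finite F\<close> cyl_sets by auto
  have disj: "disjoint_family_on cyl F"
    unfolding disjoint_family_on_def
  proof (intro ballI impI equals0I)
    fix x y \<omega> assume "x \<in> F" "y \<in> F" "x \<noteq> y" "\<omega> \<in> cyl x \<inter> cyl y"
    then have "\<forall>k\<in>?I. x k = y k" unfolding Int_iff cyl_iff by metis
    with \<open>x \<in> F\<close> \<open>y \<in> F\<close> have "x = y" unfolding F_def by (auto intro: PiE_ext)
    with \<open>x \<noteq> y\<close> show False ..
  qed
  have "\<P>(\<omega> in M. \<Phi> (\<lambda>k. X (k + d) \<omega>)) = (\<Sum>x\<in>F. prob (cyl x))"
    unfolding event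
    using \<open>finite F\<close> cyl_sets disj by (intro finite_measure_finite_Union) auto
  also have "\<dots> = (\<Sum>x\<in>F. path_weight P \<pi> a r x)"
  proof (rule sum.cong)
    fix x
    have "prob (cyl x) = path_weight P \<pi> (a + d) r (\<lambda>k. x (k - d))"
      unfolding cyl_def by (rule prob_cylinder[OF chain sub])
    also have "\<dots> = path_weight P \<pi> a r x"
      unfolding path_weight_def by (simp add: algebra_simps)
    finally show "prob (cyl x) = path_weight P \<pi> a r x" .
  qed simp
  finally show "\<P>(\<omega> in M. \<Phi> (\<lambda>k. X (k + d) \<omega>)) =
      (\<Sum>x | x \<in> {a..a + int r} \<rightarrow>\<^sub>E UNIV \<and> \<Phi> x. path_weight P \<pi> a r x)"
    unfolding F_def .
qed

section \<open>Passing to the limit\<close>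

lemma (in prob_space) tendsto_prob_of_eventually_eq:
  assumes meas: "\<And>N :: nat. {\<omega> \<in> space M. Q N \<omega>} \<in> events"
    and ev: "\<And>\<omega>. \<forall>\<^sub>F N in sequentially. Q N \<omega> = R \<omega>"
  shows "(\<lambda>N. \<P>(\<omega> in M. Q N \<omega>)) \<longlonglongrightarrow> \<P>(\<omega> in M. R \<omega>)"
proof -
  let ?q = "\<lambda>N \<omega>. indicator {\<omega> \<in> space M. Q N \<omega>} \<omega> :: real"
  let ?r = "\<lambda>\<omega>. indicator {\<omega> \<in> space M. R \<omega>} \<omega> :: real"
  have q: "?q N \<in> borel_measurable M" for N
    using meas by simp
  have lim: "(\<lambda>N. ?q N \<omega>) \<longlonglongrightarrow> ?r \<omega>" for \<omega>
    using ev[of \<omega>] by (intro tendsto_eventually) (auto elim!: eventually_mono simp: indicator_def)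
  have r: "?r \<in> borel_measurable M"
    by (rule borel_measurable_LIMSEQ_real[OF lim q])
  then have R: "{\<omega> \<in> space M. R \<omega>} \<in> events"
    unfolding borel_measurable_indicator_iff by (simp add: Int_absorb2)
  have "(\<lambda>N. \<integral>\<omega>. ?q N \<omega> \<partial>M) \<longlonglongrightarrow> (\<integral>\<omega>. ?r \<omega> \<partial>M)"
    by (rule integral_dominated_convergence[where w = "\<lambda>_. 1"]) (use q r lim in auto)
  then show ?thesis
    using meas R by (simp add: Int_absorb1)
qed

text \<open>
  By \<open>prob_window_event\<close> the probabilities on the left may be computed on \<open>M\<close>, through the window
  \<open>{-N..N}\<close> moved by \<open>d\<close>; there the events converge path by path.
\<close>

lemma tendsto_prob_window:
  fixes X :: "int \<Rightarrow> 'w \<Rightarrow> 's::finite" and XN :: "nat \<Rightarrow> int \<Rightarrow> 'v \<Rightarrow> 's"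
  assumes chains: "\<And>N. stationary_markov_chain (MN N) {- int N..int N} (XN N) P \<pi>"
    and chain: "stationary_markov_chain M UNIV X P \<pi>"
    and approx: "window_approximates \<Phi> \<Psi>"
  shows "(\<lambda>N. \<P>(\<omega> in MN N. \<Phi> N (\<lambda>k. XN N k \<omega>))) \<longlonglongrightarrow> \<P>(\<omega> in M. \<Psi> (\<lambda>k. X (k + d) \<omega>))"
proof -
  interpret prob_space M
    using chain unfolding stationary_markov_chain_def markov_chain_def by blast
  obtain N\<^sub>0 where local:
    "\<And>N x y. N\<^sub>0 \<le> N \<Longrightarrow> (\<forall>k\<in>{- int N..int N}. x k = y k) \<Longrightarrow> \<Phi> N x = \<Phi> N y"
    using approx unfolding window_approximates_def eventually_sequentially by blast
  \<comment> \<open>The window \<open>{-N..N}\<close> starts at \<open>-N\<close> and makes \<open>2 * N\<close> steps.\<close>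
  have window: "- int N + int (2 * N) = int N" for N by simp
  have local': "\<Phi> (N + N\<^sub>0) x = \<Phi> (N + N\<^sub>0) y"
    if "\<forall>k\<in>{- int (N + N\<^sub>0)..- int (N + N\<^sub>0) + int (2 * (N + N\<^sub>0))}. x k = y k" for N x y
    using that unfolding window by (intro local) auto
  have transfer: "\<P>(\<omega> in MN (N + N\<^sub>0). \<Phi> (N + N\<^sub>0) (\<lambda>k. XN (N + N\<^sub>0) k \<omega>)) =
      \<P>(\<omega> in M. \<Phi> (N + N\<^sub>0) (\<lambda>k. X (k + d) \<omega>))" for N
  proof -
    let ?a = "- int (N + N\<^sub>0)" and ?r = "2 * (N + N\<^sub>0)"
    have "{?a + 0..?a + 0 + int ?r} \<subseteq> {- int (N + N\<^sub>0)..int (N + N\<^sub>0)}" by auto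
    from prob_window_event[OF chains this, of "\<Phi> (N + N\<^sub>0)"] local'
    have "\<P>(\<omega> in MN (N + N\<^sub>0). \<Phi> (N + N\<^sub>0) (\<lambda>k. XN (N + N\<^sub>0) k \<omega>)) =
        (\<Sum>x | x \<in> {?a..?a + int ?r} \<rightarrow>\<^sub>E UNIV \<and> \<Phi> (N + N\<^sub>0) x. path_weight P \<pi> ?a ?r x)"
      unfolding add_0_right by blast
    also have "\<dots> = \<P>(\<omega> in M. \<Phi> (N + N\<^sub>0) (\<lambda>k. X (k + d) \<omega>))"
      by (rule prob_window_event[OF chain subset_UNIV, symmetric]) (rule local')
    finally show ?thesis .
  qed
  have "(\<lambda>N. \<P>(\<omega> in M. \<Phi> (N + N\<^sub>0) (\<lambda>k. X (k + d) \<omega>))) \<longlonglongrightarrow> \<P>(\<omega> in M. \<Psi> (\<lambda>k. X (k + d) \<omega>))"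
  proof (rule tendsto_prob_of_eventually_eq)
    show "{\<omega> \<in> space M. \<Phi> (N + N\<^sub>0) (\<lambda>k. X (k + d) \<omega>)} \<in> events" for N
      by (rule window_event_measurable[OF chain _ local']) simp
    show "\<forall>\<^sub>F N in sequentially. \<Phi> (N + N\<^sub>0) (\<lambda>k. X (k + d) \<omega>) = \<Psi> (\<lambda>k. X (k + d) \<omega>)" for \<omega>
      using approx unfolding window_approximates_def
      by (intro sequentially_offset) blast
  qed
  then show ?thesis
    unfolding transfer[symmetric] by (rule LIMSEQ_offset)
qed

theorem theorem5p7:
  fixes P :: "real^'s^'s" and \<pi> :: "real^'s"
    and A B :: "'s::finite set"
    and M :: "'w measure" and X :: "int \<Rightarrow> 'w \<Rightarrow> 's"
    and MN :: "nat \<Rightarrow> 'v measure" and XN :: "nat \<Rightarrow> int \<Rightarrow> 'v \<Rightarrow> 's"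
    and i j :: 's and n m :: int
  assumes "transition_matrix P" and "irreducible_matrix P"
    and "invariant_distribution P \<pi>"
    and "A \<noteq> {}" and "B \<noteq> {}" and "A \<inter> B = {}" and "- (A \<union> B) \<noteq> {}"
    and "\<And>N. stationary_markov_chain (MN N) {- int N..int N} (XN N) P \<pi>"
    and "stationary_markov_chain M UNIV X P \<pi>"
  shows
    "((\<lambda>N. q_plus (MN N) {- int N..int N} (XN N) A B i n) \<longlonglongrightarrow> q_plus M UNIV X A B i m) \<and>
     ((\<lambda>N. q_minus (MN N) {- int N..int N} (XN N) A B i n) \<longlonglongrightarrow> q_minus M UNIV X A B i m) \<and>
     ((\<lambda>N. mu_AB (MN N) {- int N..int N} (XN N) A B i n) \<longlonglongrightarrow> mu_AB M UNIV X A B i m) \<and>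
     ((\<lambda>N. f_AB (MN N) {- int N..int N} (XN N) A B i j n) \<longlonglongrightarrow> f_AB M UNIV X A B i j m) \<and>
     ((\<lambda>N. k_from_A (MN N) {- int N..int N} (XN N) A B n) \<longlonglongrightarrow> k_from_A M UNIV X A B m) \<and>
     ((\<lambda>N. k_to_B (MN N) {- int N..int N} (XN N) A B n) \<longlonglongrightarrow> k_to_B M UNIV X A B m)"
proof -
  note chains = assms(8) and chain = assms(9)
  define d where "d = m - n"
  have m: "n + d = m" "n + 1 + d = m + 1" "n - 1 + d = m - 1" by (auto simp: d_def)
  note limit = tendsto_prob_window[OF chains chain, where d = d]
  note in_set = window_approximates_state
  note at = window_approximates_state[where S = "{s}" for s, simplified]
  note fwd = window_approximates_visits_first and bwd = window_approximates_visited_last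
  note conj = window_approximates_conj
  note shift = visits_first_shift[where x = "\<lambda>k. X k \<omega>" for \<omega>]
    visited_last_shift[where x = "\<lambda>k. X k \<omega>" for \<omega>]
  note event_simps = tau_plus_less_iff tau_minus_less_iff shift m
  have initial: "\<P>(\<omega> in M. X m \<omega> = i) = \<pi> $ i"
    using chain unfolding stationary_markov_chain_def by simp
  have initial_N: "\<forall>\<^sub>F N in sequentially. \<P>(\<omega> in MN N. XN N n \<omega> = i) = \<pi> $ i"
    using eventually_in_window[of n]
    by eventually_elim (use chains in \<open>auto simp: stationary_markov_chain_def\<close>)
  have quotient: "(\<lambda>N. p N / \<P>(\<omega> in MN N. XN N n \<omega> = i)) \<longlonglongrightarrow> l / \<pi> $ i" if "p \<longlonglongrightarrow> l" for p l
  proof (rule Lim_transform_eventually)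
    \<comment> \<open>As multiplication by a constant, so that \<open>\<pi> $ i = 0\<close> is no special case.\<close>
    show "(\<lambda>N. p N * inverse (\<pi> $ i)) \<longlonglongrightarrow> l / \<pi> $ i"
      using tendsto_mult_right[OF that, of "inverse (\<pi> $ i)"] by (simp add: divide_inverse)
    show "\<forall>\<^sub>F N in sequentially.
        p N * inverse (\<pi> $ i) = p N / \<P>(\<omega> in MN N. XN N n \<omega> = i)"
      using initial_N by eventually_elim (simp add: divide_inverse)
  qed
  have "(\<lambda>N. q_plus (MN N) {- int N..int N} (XN N) A B i n) \<longlonglongrightarrow> q_plus M UNIV X A B i m"
    unfolding q_plus_def cond_prob_def initial event_simps
    using limit[OF conj[OF fwd[of n A B] at[of n i]]] unfolding event_simps by (rule quotient)
  moreover
  have "(\<lambda>N. q_minus (MN N) {- int N..int N} (XN N) A B i n) \<longlonglongrightarrow> q_minus M UNIV X A B i m"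
    unfolding q_minus_def cond_prob_def initial event_simps
    using limit[OF conj[OF bwd[of n A B] at[of n i]]] unfolding event_simps by (rule quotient)
  moreover
  have "(\<lambda>N. mu_AB (MN N) {- int N..int N} (XN N) A B i n) \<longlonglongrightarrow> mu_AB M UNIV X A B i m"
    unfolding mu_AB_def event_simps
    using limit[OF conj[OF at[of n i] conj[OF bwd[of n A B] fwd[of n A B]]]]
    unfolding event_simps .
  moreover
  have "(\<lambda>N. f_AB (MN N) {- int N..int N} (XN N) A B i j n) \<longlonglongrightarrow> f_AB M UNIV X A B i j m"
    unfolding f_AB_def event_simps
    using limit[OF conj[OF at[of n i]
        conj[OF at[of "n + 1" j] conj[OF bwd[of n A B] fwd[of "n + 1" A B]]]]]
    unfolding event_simps .
  moreover
  have "(\<lambda>N. k_from_A (MN N) {- int N..int N} (XN N) A B n) \<longlonglongrightarrow> k_from_A M UNIV X A B m"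
    unfolding k_from_A_def event_simps
    using limit[OF conj[OF in_set[of n A] fwd[of "n + 1" A B]]] unfolding event_simps .
  moreover
  have "(\<lambda>N. k_to_B (MN N) {- int N..int N} (XN N) A B n) \<longlonglongrightarrow> k_to_B M UNIV X A B m"
    unfolding k_to_B_def event_simps
    using limit[OF conj[OF in_set[of n B] bwd[of "n - 1" A B]]] unfolding event_simps .
  ultimately show ?thesis by blast
qed

end
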